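(* Let $\{a_n\}_{n\ge0}$ be a sequence of nonzero real numbers and set $u_n=\dfrac{a_{n-1}a_{n+1}}{a_n^2}$ for $n\ge1$. Suppose there exist an integer $N_1$ and real sequences $\{f_n\}$ (upper bound) and $\{g_n\}$ (lower bound) such that $0<g_n<u_n<f_n$ for all $n\ge N_1$, and integers $N_2,N_3,N_4$ such that \[ g_n>1 \ (n\ge N_2),\qquad g_n-f_{n+1}>0 \ (n\ge N_3),\qquad g_{n-1}g_{n+1}-f_n^2>0 \ (n\ge N_4). \] Let $N=\max\{N_1,N_2,N_3,N_4\}$. Then $\{a_n\}_{n\ge N}$ is log-monotonic of order three.
   Context: Let $\varphi$ be the operator on sequences sending $\{a_n\}$ to $\{a_{n+1}/a_n\}$ (indexed over the same index set, where defined), with iterates $\varphi^k$, $\varphi^0$ the identity. A sequence $\{c_n\}$ is log-concave if $c_n^2-c_{n-1}c_{n+1}\ge0$ and log-convex if $c_n^2-c_{n-1}c_{n+1}\le0$ for all admissible $n$ (i.e. all $n$ with $n-1,n,n+1$ in the index set). A sequence is log-monotonic of order three if the sequence itself and $\varphi^2$ of it are log-convex and $\varphi$ of it is log-concave. *)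

theory Defs
  imports Complex_Main
begin

text \<open>A real sequence together with its index set; values outside the index set are irrelevant.\<close>

type_synonym iseq = "nat set \<times> (nat \<Rightarrow> real)"

text \<open>The index set shrinks to the indices at which the quotient is defined.\<close>

definition ratio_op :: "iseq \<Rightarrow> iseq" where
  "ratio_op = (\<lambda>(I, c). ({n \<in> I. n + 1 \<in> I \<and> c n \<noteq> 0}, \<lambda>n. c (n + 1) / c n))"

text \<open>The bound \<open>n \<ge> 1\<close> only rules out truncated subtraction in \<open>n - 1\<close>.\<close>

definition log_concave :: "iseq \<Rightarrow> bool" where
  "log_concave = (\<lambda>(I, c). \<forall>n\<ge>1. n - 1 \<in> I \<and> n \<in> I \<and> n + 1 \<in> I \<longrightarrow>
     (c n)\<^sup>2 - c (n - 1) * c (n + 1) \<ge> 0)"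

definition log_convex :: "iseq \<Rightarrow> bool" where
  "log_convex = (\<lambda>(I, c). \<forall>n\<ge>1. n - 1 \<in> I \<and> n \<in> I \<and> n + 1 \<in> I \<longrightarrow>
     (c n)\<^sup>2 - c (n - 1) * c (n + 1) \<le> 0)"

definition log_monotonic_order_three :: "iseq \<Rightarrow> bool" where
  "log_monotonic_order_three s \<longleftrightarrow>
     log_convex s \<and> log_convex ((ratio_op ^^ 2) s) \<and> log_concave (ratio_op s)"

end

theory Submission
  imports Defs
begin

text \<open>The quantity \<open>u\<^sub>n\<close> is the quotient of two consecutive terms of \<open>\<phi>(a)\<close>, so \<open>\<phi>\<^sup>2(a)\<close> is the
  sequence \<open>u\<close> shifted by one. The three conditions then say, respectively, that \<open>u \<ge> 1\<close>, that \<open>u\<close> decreases,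
  and that \<open>u\<close> is log-convex; the bounds \<open>f\<close> and \<open>g\<close> separate the terms being compared.\<close>

lemma snd_ratio_op_twice:
  "snd ((ratio_op ^^ 2) (I, a)) n = a n * a (n + 2) / (a (n + 1))\<^sup>2"
  by (simp add: ratio_op_def numeral_2_eq_2 power2_eq_square)

lemma fst_ratio_op_subset: "fst (ratio_op s) \<subseteq> fst s"
  by (auto simp: ratio_op_def split: prod.splits)

text \<open>Setting \<open>m = n - 1\<close> makes the first index of the triple the parameter and
  removes truncated subtraction. Membership of that index alone is kept: the index sets arising here
  lie in a tail, so it controls the later indices too.\<close>

lemma log_convexI:
  assumes "\<And>m. m \<in> fst s \<Longrightarrow> (snd s (m + 1))\<^sup>2 \<le> snd s m * snd s (m + 2)"
  shows "log_convex s"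
  unfolding log_convex_def
proof (clarsimp split: prod.splits)
  fix I c and n :: nat
  assume "s = (I, c)" "Suc 0 \<le> n" "n - Suc 0 \<in> I"
  with assms[of "n - 1"] show "(c n)\<^sup>2 \<le> c (n - Suc 0) * c (Suc n)" by simp
qed

lemma log_concaveI:
  assumes "\<And>m. m \<in> fst s \<Longrightarrow> snd s m * snd s (m + 2) \<le> (snd s (m + 1))\<^sup>2"
  shows "log_concave s"
  unfolding log_concave_def
proof (clarsimp split: prod.splits)
  fix I c and n :: nat
  assume "s = (I, c)" "Suc 0 \<le> n" "n - Suc 0 \<in> I"
  with assms[of "n - 1"] show "c (n - Suc 0) * c (Suc n) \<le> (c n)\<^sup>2" by simp
qed

theorem theorem4p1:
  fixes a u f g :: "nat \<Rightarrow> real" and N1 N2 N3 N4 N :: int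
  assumes "\<forall>n. a n \<noteq> 0"
    and "\<forall>n\<ge>1. u n = a (n - 1) * a (n + 1) / (a n)\<^sup>2"
    and "\<forall>n\<ge>1. int n \<ge> N1 \<longrightarrow> 0 < g n \<and> g n < u n \<and> u n < f n"
    and "\<forall>n\<ge>1. int n \<ge> N2 \<longrightarrow> g n > 1"
    and "\<forall>n\<ge>1. int n \<ge> N3 \<longrightarrow> g n - f (n + 1) > 0"
    and "\<forall>n\<ge>2. int n \<ge> N4 \<longrightarrow> g (n - 1) * g (n + 1) - (f n)\<^sup>2 > 0"
    and "N = Max {N1, N2, N3, N4}"
  shows "log_monotonic_order_three ({n. int n \<ge> N}, a)"
proof -
  let ?I = "{n. int n \<ge> N}"
  \<comment> \<open>The shift to \<open>m + 1\<close> and \<open>m + 2\<close> meets the side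
    conditions \<open>n \<ge> 1\<close> and \<open>n \<ge> 2\<close> of the hypotheses, even when
    \<open>N\<close> is negative and \<open>m = 0\<close>.\<close>
  have bounds: "1 < g (m + 1)" "g (m + 1) < u (m + 1)" "u (m + 1) < f (m + 1)"
      "f (m + 2) < g (m + 1)" "(f (m + 2))\<^sup>2 < g (m + 1) * g (m + 3)"
    if "int m \<ge> N" for m
  proof -
    have le: "int m \<ge> N1" "int m \<ge> N2" "int m \<ge> N3" "int m \<ge> N4"
      using that assms(7) by auto
    show "1 < g (m + 1)" "g (m + 1) < u (m + 1)" "u (m + 1) < f (m + 1)"
      using le assms(3,4) by auto
    show "f (m + 2) < g (m + 1)"
      using le assms(5)[rule_format, of "m + 1"] by simp
    show "(f (m + 2))\<^sup>2 < g (m + 1) * g (m + 3)"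
      using le assms(6)[rule_format, of "m + 2"] by (simp add: numeral_3_eq_3)
  qed
  have u: "u (m + 1) = a m * a (m + 2) / (a (m + 1))\<^sup>2" for m
    using assms(2) by simp
  have nz: "a n \<noteq> 0" for n
    using assms(1) by simp

  have "log_convex (?I, a)"
  proof (rule log_convexI)
    fix m assume "m \<in> fst (?I, a)"
    with bounds[of m] have "1 < u (m + 1)" by simp
    with nz show "(snd (?I, a) (m + 1))\<^sup>2 \<le> snd (?I, a) m * snd (?I, a) (m + 2)"
      unfolding u by (simp add: less_divide_eq)
  qed
  moreover have "log_convex ((ratio_op ^^ 2) (?I, a))"
  proof (rule log_convexI)
    fix m assume "m \<in> fst ((ratio_op ^^ 2) (?I, a))"
    then have "m \<in> ?I"
      using fst_ratio_op_subset[of "ratio_op (?I, a)"] fst_ratio_op_subset[of "(?I, a)"]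
      by (auto simp: numeral_2_eq_2)
    then have b: "int m \<ge> N" "int (m + 1) \<ge> N" "int (m + 2) \<ge> N" by auto
    \<comment> \<open>Squaring keeps the order because \<open>u (m + 2)\<close> exceeds
      \<open>g (m + 2) > 1\<close>.\<close>
    have "(u (m + 2))\<^sup>2 \<le> (f (m + 2))\<^sup>2"
      using bounds[OF b(2)] by (intro power_mono) (auto simp: numeral_eq_Suc)
    also have "\<dots> \<le> g (m + 1) * g (m + 3)"
      using bounds[OF b(1)] by simp
    also have "\<dots> \<le> u (m + 1) * u (m + 3)"
      using bounds[OF b(1)] bounds[OF b(3)] by (intro mult_mono) (auto simp: numeral_eq_Suc)
    finally show "(snd ((ratio_op ^^ 2) (?I, a)) (m + 1))\<^sup>2
        \<le> snd ((ratio_op ^^ 2) (?I, a)) m * snd ((ratio_op ^^ 2) (?I, a)) (m + 2)"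
      using u[of m] u[of "m + 1"] u[of "m + 2"]
      unfolding snd_ratio_op_twice by (simp add: numeral_eq_Suc)
  qed
  moreover have "log_concave (ratio_op (?I, a))"
  proof (rule log_concaveI)
    fix m assume "m \<in> fst (ratio_op (?I, a))"
    then have b: "int m \<ge> N" "int (m + 1) \<ge> N"
      using fst_ratio_op_subset[of "(?I, a)"] by auto
    define r where "r n = a (n + 1) / a n" for n
    have r: "snd (ratio_op (?I, a)) = r"
      by (simp add: ratio_op_def r_def fun_eq_iff)
    have step: "r (n + 1) = r n * u (n + 1)" for n
      unfolding u r_def using nz by (simp add: field_simps power2_eq_square)
    \<comment> \<open>The chain is
      \<open>u (m + 2) < f (m + 2) < g (m + 1) < u (m + 1)\<close>.\<close>
    have dec: "u (m + 2) \<le> u (m + 1)" and pos: "0 \<le> u (m + 1)"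
      using bounds[OF b(1)] bounds[OF b(2)] by (auto simp: numeral_eq_Suc)
    \<comment> \<open>The signs of \<open>a\<close>, hence of \<open>r\<close>, are arbitrary.
      Pulling out the square of \<open>r m\<close> leaves a comparison between values of
      \<open>u\<close> only, which are positive.\<close>
    have "r m * r (m + 2) = (r m)\<^sup>2 * (u (m + 1) * u (m + 2))"
      using step[of m] step[of "m + 1"] by (simp add: power2_eq_square)
    also have "\<dots> \<le> (r m)\<^sup>2 * (u (m + 1) * u (m + 1))"
      using dec pos by (intro mult_left_mono) auto
    also have "\<dots> = (r (m + 1))\<^sup>2"
      using step[of m] by (simp add: power2_eq_square)
    finally show "snd (ratio_op (?I, a)) m * snd (ratio_op (?I, a)) (m + 2)
        \<le> (snd (ratio_op (?I, a)) (m + 1))\<^sup>2"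
      unfolding r .
  qed
  ultimately show ?thesis
    by (simp add: log_monotonic_order_three_def)
qed

end
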